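(* Let $G$ be a group with property $\mathrm{PHP}$ and let $H\leq G$ be a subgroup of finite index. Then $H$ has property $\mathrm{PHP}$.
   Context: Property $\mathrm{PHP}$ (Ozawa): a group $G$ has property $\mathrm{PHP}$ if for every finite $F\subseteq G$ and every $\varepsilon>0$ there exists $N\geq 1$ such that for all integers $n\geq N$ there are elements $t_1,\ldots,t_n\in G$ and subsets $C_i\subseteq D_i\subseteq G$ ($1\leq i\leq n$) such that: (1) the sets $aC_i$ ($a\in F$, $1\leq i\leq n$) together with the sets $at_i^{-1}(G\setminus D_i)$ ($a\in F$, $1\leq i\leq n$) are pairwise disjoint, as an indexed family (i.e. members with different type or different index $(a,i)$ are disjoint); (2) for every $x\in G$, the set $J(x):=\{i: x\in D_i\}\cup\{i: x\in t_i^{-1}(G\setminus C_i)\}$ has cardinality at most $\varepsilon\sqrt{n}$. *)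

theory Defs
  imports "HOL-Algebra.Algebra" "HOL-Library.Disjoint_Sets" Complex_Main
begin

text \<open>
  Property PHP (Ozawa).  The family required to be disjoint is indexed by the disjoint union of
  two copies of \<open>F \<times> {1..n}\<close>: \<open>Inl (a, i)\<close> is the index of \<open>a C\<^sub>i\<close>, and \<open>Inr (a, i)\<close> is the
  index of \<open>a t\<^sub>i\<inverse> (G - D\<^sub>i)\<close>.
\<close>

definition property_PHP :: "('a, 'b) monoid_scheme \<Rightarrow> bool" where
  "property_PHP G \<longleftrightarrow>
    (\<forall>F (\<epsilon>::real). finite F \<longrightarrow> F \<subseteq> carrier G \<longrightarrow> \<epsilon> > 0 \<longrightarrow>
      (\<exists>N::nat. N \<ge> 1 \<and>
        (\<forall>n::nat. n \<ge> N \<longrightarrow>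
          (\<exists>(t :: nat \<Rightarrow> 'a) (C :: nat \<Rightarrow> 'a set) (D :: nat \<Rightarrow> 'a set).
            (\<forall>i\<in>{1..n}. t i \<in> carrier G \<and> C i \<subseteq> D i \<and> D i \<subseteq> carrier G) \<and>
            disjoint_family_on
              (case_sum
                (\<lambda>(a, i). a <#\<^bsub>G\<^esub> C i)
                (\<lambda>(a, i). (a \<otimes>\<^bsub>G\<^esub> inv\<^bsub>G\<^esub> (t i)) <#\<^bsub>G\<^esub> (carrier G - D i)))
              ((F \<times> {1..n}) <+> (F \<times> {1..n})) \<and>
            (\<forall>x\<in>carrier G.
              real (card ({i\<in>{1..n}. x \<in> D i} \<union>
                          {i\<in>{1..n}. x \<in> inv\<^bsub>G\<^esub> (t i) <#\<^bsub>G\<^esub> (carrier G - C i)}))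
                \<le> \<epsilon> * sqrt (real n))))))"

end

theory Submission
  imports Defs
begin

text \<open>
  Let \<open>U \<ni> \<one>\<close> be a finite set with \<open>G = H U\<close>.  Apply \<open>PHP\<close> of \<open>G\<close> to \<open>F U\<close> and
  \<open>\<epsilon> / |U|\<close>, write \<open>t\<^sub>i = h\<^sub>i u\<^sub>i\<close>, and use \<open>h\<^sub>i\<close>, \<open>H \<inter> C\<^sub>i\<close>, \<open>H \<inter> D\<^sub>i\<close> for \<open>H\<close>.
  Since \<open>a h\<^sub>i\<inverse> = (a u\<^sub>i) t\<^sub>i\<inverse>\<close>, the new sets lie in sets of the old family with distinct
  indices, and the new \<open>J(x)\<close> lies in the union of the old \<open>J(u\<inverse> x)\<close> over \<open>u \<in> U\<close>.
\<close>

text \<open>One representative is chosen in each right coset. The factor from \<open>H\<close>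
  stands on the left so that \<open>inv h = u \<otimes> inv t\<close>; the finite correction
  \<open>u\<close> can then be absorbed into the finite set \<open>F\<close>.\<close>

lemma (in group) finite_transversal:
  assumes H: "subgroup H G" and fin: "finite (rcosets H)"
  obtains U where "finite U" "U \<subseteq> carrier G" "\<one> \<in> U"
    "\<And>t. t \<in> carrier G \<Longrightarrow> \<exists>h\<in>H. \<exists>u\<in>U. t = h \<otimes> u"
proof -
  obtain r where r: "\<And>c. c \<in> rcosets H \<Longrightarrow> r c \<in> carrier G \<and> c = H #> r c"
  proof -
    have "\<forall>c\<in>rcosets H. \<exists>x. x \<in> carrier G \<and> c = H #> x"
      unfolding RCOSETS_def by auto
    then show thesis using that by metis
  qed
  show thesis
  \<comment> \<open>The choice \<open>r\<close> may represent \<open>H\<close> by another element,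
    so \<open>\<one>\<close> is added by hand.\<close>
  proof (rule that[of "insert \<one> (r ` (rcosets H))"])
    fix t assume t: "t \<in> carrier G"
    have c: "H #> t \<in> rcosets H"
      using t H by (simp add: rcosetsI subgroup.subset)
    have "t \<in> H #> t" by (rule rcos_self[OF t H])
    then have "t \<in> H #> r (H #> t)" using r[OF c] by simp
    then show "\<exists>h\<in>H. \<exists>u\<in>insert \<one> (r ` (rcosets H)). t = h \<otimes> u"
      using c unfolding r_coset_def by blast
  qed (use fin r in auto)
qed

lemma (in group) mem_l_coset_iff:
  assumes "g \<in> carrier G" "A \<subseteq> carrier G" "x \<in> carrier G"
  shows "x \<in> g <#\<^bsub>G\<^esub> A \<longleftrightarrow> inv g \<otimes> x \<in> A"
proof
  assume "x \<in> g <#\<^bsub>G\<^esub> A"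
  then show "inv g \<otimes> x \<in> A"
    using assms unfolding l_coset_def by (auto simp: m_assoc[symmetric] subset_iff)
next
  assume "inv g \<otimes> x \<in> A"
  moreover have "x = g \<otimes> (inv g \<otimes> x)"
    using assms by (simp add: m_assoc[symmetric])
  ultimately show "x \<in> g <#\<^bsub>G\<^esub> A" unfolding l_coset_def by blast
qed

text \<open>Carries disjointness from the family in \<open>G\<close> to the one in \<open>H\<close>:
  injectivity of \<open>f\<close> keeps distinct indices distinct, and subsets of disjoint sets are
  disjoint.\<close>

lemma disjoint_family_on_reindex_mono:
  assumes "disjoint_family_on B J" "inj_on f I" "f ` I \<subseteq> J" "\<And>i. i \<in> I \<Longrightarrow> A i \<subseteq> B (f i)"
  shows "disjoint_family_on A I"
  unfolding disjoint_family_on_def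
proof (intro ballI impI)
  fix i j assume ij: "i \<in> I" "j \<in> I" "i \<noteq> j"
  then have "B (f i) \<inter> B (f j) = {}"
    using assms by (intro disjoint_family_onD[OF assms(1)]) (auto dest: inj_onD)
  then show "A i \<inter> A j = {}" using assms(4) ij by blast
qed

text \<open>The innermost condition of \<open>property_PHP\<close> for a single \<open>n\<close>,
  with \<open>\<epsilon> * sqrt (real n)\<close> abstracted to \<open>\<delta>\<close>, so that
  passing to \<open>H\<close> involves neither \<open>\<epsilon>\<close> nor
  \<open>N\<close>.\<close>

definition PHP_witness ::
  "('a, 'b) monoid_scheme \<Rightarrow> 'a set \<Rightarrow> nat \<Rightarrow> real \<Rightarrow>
    (nat \<Rightarrow> 'a) \<Rightarrow> (nat \<Rightarrow> 'a set) \<Rightarrow> (nat \<Rightarrow> 'a set) \<Rightarrow> bool"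
  where "PHP_witness G F n \<delta> t C D \<longleftrightarrow>
    (\<forall>i\<in>{1..n}. t i \<in> carrier G \<and> C i \<subseteq> D i \<and> D i \<subseteq> carrier G) \<and>
    disjoint_family_on
      (case_sum (\<lambda>(a, i). a <#\<^bsub>G\<^esub> C i)
        (\<lambda>(a, i). (a \<otimes>\<^bsub>G\<^esub> inv\<^bsub>G\<^esub> (t i)) <#\<^bsub>G\<^esub> (carrier G - D i)))
      (Sum_Type.Plus (F \<times> {1..n}) (F \<times> {1..n})) \<and>
    (\<forall>x\<in>carrier G. real (card ({i\<in>{1..n}. x \<in> D i} \<union>
        {i\<in>{1..n}. x \<in> inv\<^bsub>G\<^esub> (t i) <#\<^bsub>G\<^esub> (carrier G - C i)})) \<le> \<delta>)"

lemma property_PHP_iff_witness: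
  "property_PHP G \<longleftrightarrow> (\<forall>F (\<epsilon>::real). finite F \<longrightarrow> F \<subseteq> carrier G \<longrightarrow> \<epsilon> > 0 \<longrightarrow>
    (\<exists>N::nat. N \<ge> 1 \<and> (\<forall>n\<ge>N. \<exists>t C D. PHP_witness G F n (\<epsilon> * sqrt (real n)) t C D)))"
  by (simp only: property_PHP_def PHP_witness_def)

text \<open>The construction works for each \<open>n\<close> separately. Its only cost is the factor
  \<open>card U\<close>, the number of old sets \<open>J(inv v \<otimes> x)\<close> needed to cover
  a new \<open>J(x)\<close>.\<close>

lemma (in group) PHP_witness_subgroup:
  assumes H: "subgroup H G"
    and U: "finite U" "U \<subseteq> carrier G" "\<one> \<in> U"
    and HU: "\<And>t. t \<in> carrier G \<Longrightarrow> \<exists>h\<in>H. \<exists>u\<in>U. t = h \<otimes> u"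
    and FH: "F \<subseteq> H"
    and wit: "PHP_witness G ((\<lambda>(a, u). a \<otimes> u) ` (F \<times> U)) n \<delta> t C D"
  shows "\<exists>h. PHP_witness (G\<lparr>carrier := H\<rparr>) F n (real (card U) * \<delta>) h (\<lambda>i. H \<inter> C i) (\<lambda>i. H \<inter> D i)"
proof -
  let ?K = "G\<lparr>carrier := H\<rparr>"
  have FH: "a \<in> H" if "a \<in> F" for a using FH that by blast
  have HG: "h \<in> carrier G" if "h \<in> H" for h using that subgroup.subset[OF H] by blast
  have invK: "inv\<^bsub>?K\<^esub> h = inv h" if "h \<in> H" for h
    using m_inv_consistent[OF H that] .
  define F' where "F' = (\<lambda>(a, u). a \<otimes> u) ` (F \<times> U)"
  note w = wit[folded F'_def, unfolded PHP_witness_def]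
  have tCD: "t i \<in> carrier G \<and> C i \<subseteq> D i \<and> D i \<subseteq> carrier G" if "i \<in> {1..n}" for i
    using w[THEN conjunct1] that by (rule bspec)
  note disj = w[THEN conjunct2, THEN conjunct1]
  note bound = w[THEN conjunct2, THEN conjunct2, rule_format]
  have "\<forall>i\<in>{1..n}. \<exists>h u. h \<in> H \<and> u \<in> U \<and> t i = h \<otimes> u"
    using HU tCD by blast
  then obtain h u where hu: "\<And>i. i \<in> {1..n} \<Longrightarrow> h i \<in> H \<and> u i \<in> U \<and> t i = h i \<otimes> u i"
    by metis
  have G: "h i \<in> carrier G" "u i \<in> carrier G" if "i \<in> {1..n}" for i
    using hu[OF that] HG U by auto
  have inv_h: "inv (h i) = u i \<otimes> inv (t i)" if "i \<in> {1..n}" for i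
    using hu[OF that] G[OF that] by (simp add: inv_mult_group m_assoc[symmetric])
  \<comment> \<open>Sets of the first type keep their index, which is allowed because
    \<open>\<one> \<in> U\<close> gives \<open>F \<subseteq> F'\<close>. In the second type
    \<open>a\<close> becomes \<open>a \<otimes> u i\<close>; as \<open>i\<close> is kept, right
    cancellation of \<open>u i\<close> makes \<open>f\<close> injective.\<close>
  define f :: "'a \<times> nat + 'a \<times> nat \<Rightarrow> _" where
    "f = map_sum id (\<lambda>(a, i). (a \<otimes> u i, i))"
  have disjK: "disjoint_family_on
    (case_sum (\<lambda>(a, i). a <#\<^bsub>?K\<^esub> (H \<inter> C i))
      (\<lambda>(a, i). (a \<otimes>\<^bsub>?K\<^esub> inv\<^bsub>?K\<^esub> (h i)) <#\<^bsub>?K\<^esub> (carrier ?K - H \<inter> D i)))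
    (Sum_Type.Plus (F \<times> {1..n}) (F \<times> {1..n}))"
  proof (rule disjoint_family_on_reindex_mono[OF disj, where f = f])
    show "inj_on f (Sum_Type.Plus (F \<times> {1..n}) (F \<times> {1..n}))"
      using G HG FH by (auto simp: inj_on_def f_def)
    have FU: "a \<otimes> v \<in> F'" if "a \<in> F" "v \<in> U" for a v
      using that by (force simp: F'_def)
    have "a \<in> F'" if "a \<in> F" for a
      using FU[OF that U(3)] HG[OF FH[OF that]] by simp
    then show "f ` (Sum_Type.Plus (F \<times> {1..n}) (F \<times> {1..n}))
        \<subseteq> Sum_Type.Plus (F' \<times> {1..n}) (F' \<times> {1..n})"
      using hu FU by (auto simp: f_def)
    fix p assume p: "p \<in> Sum_Type.Plus (F \<times> {1..n}) (F \<times> {1..n})"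
    show "case_sum (\<lambda>(a, i). a <#\<^bsub>?K\<^esub> (H \<inter> C i))
        (\<lambda>(a, i). (a \<otimes>\<^bsub>?K\<^esub> inv\<^bsub>?K\<^esub> (h i)) <#\<^bsub>?K\<^esub> (carrier ?K - H \<inter> D i)) p
      \<subseteq> case_sum (\<lambda>(a, i). a <#\<^bsub>G\<^esub> C i)
        (\<lambda>(a, i). (a \<otimes> inv (t i)) <#\<^bsub>G\<^esub> (carrier G - D i)) (f p)"
    proof (cases p)
      case (Inl q)
      then show ?thesis by (auto simp: f_def l_coset_def split: prod.splits)
    next
      case (Inr q)
      then obtain a i where q: "q = (a, i)" "a \<in> F" "i \<in> {1..n}" using p by auto
      have "a \<otimes> inv (h i) = (a \<otimes> u i) \<otimes> inv (t i)"
        using q inv_h G tCD HG FH by (simp add: m_assoc)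
      \<comment> \<open>The translating elements agree, and
        \<open>H - H \<inter> D i \<subseteq> carrier G - D i\<close>.\<close>
      then show ?thesis
        using Inr q hu[OF q(3)] HG by (auto simp: f_def l_coset_def invK)
    qed
  qed
  have boundK: "real (card ({i\<in>{1..n}. x \<in> H \<inter> D i} \<union>
      {i\<in>{1..n}. x \<in> inv\<^bsub>?K\<^esub> (h i) <#\<^bsub>?K\<^esub> (carrier ?K - H \<inter> C i)})) \<le> real (card U) * \<delta>"
    (is "real (card ?J) \<le> _") if x: "x \<in> H" for x
  proof -
    define J where "J y = {i\<in>{1..n}. y \<in> D i} \<union>
        {i\<in>{1..n}. y \<in> inv (t i) <#\<^bsub>G\<^esub> (carrier G - C i)}" for y
    have xG: "x \<in> carrier G" using x HG by blast
    \<comment> \<open>An index with \<open>x \<in> D i\<close> is caught by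
      \<open>v = \<one>\<close>, any other by \<open>v = u i\<close>.\<close>
    have "?J \<subseteq> (\<Union>v\<in>U. J (inv v \<otimes> x))"
    proof
      fix i assume i: "i \<in> ?J"
      then have i1: "i \<in> {1..n}" by blast
      note hi = hu[OF i1] G[OF i1]
      from i consider "x \<in> D i" | "x \<in> inv (h i) <#\<^bsub>G\<^esub> (carrier G - C i)"
        using invK hi HG by (auto simp: l_coset_def)
      then show "i \<in> (\<Union>v\<in>U. J (inv v \<otimes> x))"
      proof cases
        case 1
        then have "i \<in> J (inv \<one> \<otimes> x)" using i1 xG by (simp add: J_def)
        then show ?thesis using U(3) by blast
      next
        case 2
        \<comment> \<open>Case 2 says \<open>h i \<otimes> x \<notin> C i\<close>. Since
          \<open>h i \<otimes> x = t i \<otimes> (inv (u i) \<otimes> x)\<close>, this is the second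
          condition of \<open>J\<close> at \<open>inv (u i) \<otimes> x\<close>.\<close>
        have "t i \<otimes> (inv (u i) \<otimes> x) = h i \<otimes> (u i \<otimes> inv (u i)) \<otimes> x"
          using hi xG by (simp only: m_assoc m_closed inv_closed)
        then have "t i \<otimes> (inv (u i) \<otimes> x) = h i \<otimes> x" using hi xG by simp
        then have "inv (u i) \<otimes> x \<in> inv (t i) <#\<^bsub>G\<^esub> (carrier G - C i)"
          using 2 hi xG tCD[OF i1] by (simp add: mem_l_coset_iff)
        then have "i \<in> J (inv (u i) \<otimes> x)" using i1 by (simp add: J_def)
        then show ?thesis using hi by blast
      qed
    qed
    then have "card ?J \<le> card (\<Union>v\<in>U. J (inv v \<otimes> x))"
      by (rule card_mono[rotated]) (use U in \<open>auto simp: J_def\<close>)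
    also have "\<dots> \<le> (\<Sum>v\<in>U. card (J (inv v \<otimes> x)))"
      by (rule card_UN_le[OF U(1)])
    finally have "real (card ?J) \<le> (\<Sum>v\<in>U. real (card (J (inv v \<otimes> x))))"
      by (simp flip: of_nat_sum)
    \<comment> \<open>The points \<open>inv v \<otimes> x\<close> may leave \<open>H\<close>; the
      bound for \<open>G\<close> holds at all of them.\<close>
    also have "\<dots> \<le> (\<Sum>v\<in>U. \<delta>)"
      unfolding J_def using U xG by (intro sum_mono bound) auto
    also have "\<dots> = real (card U) * \<delta>" by simp
    finally show ?thesis .
  qed
  show ?thesis
    unfolding PHP_witness_def
  proof (intro exI conjI)
    show "\<forall>i\<in>{1..n}. h i \<in> carrier ?K \<and> H \<inter> C i \<subseteq> H \<inter> D i \<and> H \<inter> D i \<subseteq> carrier ?K"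
      using hu tCD by fastforce
    show "\<forall>x\<in>carrier ?K. real (card ({i\<in>{1..n}. x \<in> H \<inter> D i} \<union>
      {i\<in>{1..n}. x \<in> inv\<^bsub>?K\<^esub> (h i) <#\<^bsub>?K\<^esub> (carrier ?K - H \<inter> C i)})) \<le> real (card U) * \<delta>"
      using boundK by simp
  qed (fact disjK)
qed

theorem proposition2p3:
  fixes G :: "('a, 'b) monoid_scheme" and H :: "'a set"
  assumes "group G"
    and "property_PHP G"
    and "subgroup H G"
    and "finite (rcosets\<^bsub>G\<^esub> H)"
  shows "property_PHP (G\<lparr>carrier := H\<rparr>)"
proof -
  interpret group G by fact
  obtain U where U: "finite U" "U \<subseteq> carrier G" "\<one>\<^bsub>G\<^esub> \<in> U"
    and HU: "\<And>t. t \<in> carrier G \<Longrightarrow> \<exists>h\<in>H. \<exists>u\<in>U. t = h \<otimes>\<^bsub>G\<^esub> u"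
    using finite_transversal[OF assms(3,4)] by blast
  have kpos: "real (card U) > 0" using U by (auto simp: card_gt_0_iff)
  show ?thesis
    unfolding property_PHP_iff_witness
  proof (intro allI impI)
    fix F and \<epsilon> :: real
    assume F: "finite F" "F \<subseteq> carrier (G\<lparr>carrier := H\<rparr>)" and \<epsilon>: "\<epsilon> > 0"
    then have FH: "F \<subseteq> H" by simp
    let ?F' = "(\<lambda>(a, u). a \<otimes>\<^bsub>G\<^esub> u) ` (F \<times> U)"
    \<comment> \<open>Dividing \<open>\<epsilon>\<close> by \<open>card U\<close> cancels the factor
      lost in passing to \<open>H\<close>. The \<open>N\<close> obtained for \<open>G\<close> from
      these data then serves for \<open>H\<close> unchanged.\<close>
    have F': "finite ?F'" "?F' \<subseteq> carrier G" "\<epsilon> / card U > 0"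
      using F U FH subgroup.subset[OF assms(3)] \<epsilon> kpos by auto
    obtain N where N: "N \<ge> 1"
      and wit: "\<And>n. n \<ge> N \<Longrightarrow> \<exists>t C D. PHP_witness G ?F' n (\<epsilon> / card U * sqrt (real n)) t C D"
      using assms(2)[unfolded property_PHP_iff_witness, rule_format, OF F'] by blast
    have "\<exists>t C D. PHP_witness (G\<lparr>carrier := H\<rparr>) F n (\<epsilon> * sqrt (real n)) t C D" if n: "n \<ge> N" for n
    proof -
      obtain t C D where "PHP_witness G ?F' n (\<epsilon> / card U * sqrt (real n)) t C D"
        using wit[OF n] by blast
      from PHP_witness_subgroup[OF assms(3) U HU FH this] show ?thesis
        using kpos by (simp add: mult.assoc) blast
    qed
    with N show "\<exists>N\<ge>1. \<forall>n\<ge>N. \<exists>t C D.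
        PHP_witness (G\<lparr>carrier := H\<rparr>) F n (\<epsilon> * sqrt (real n)) t C D"
      by blast
  qed
qed

end
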